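(* Let $m\geq 2$ be a natural number and let $\beta$ be a non-zero complex number such that $\Re(\beta)\geq 0$. Consider the integral $$H_m^{\beta}(x)=\frac{1}{2\pi}\int_{\mathbb{R}}e^{-ixu}e^{-\beta u^m}\,du,\qquad x\in\mathbb{R}.$$ 1. If $m$ is even and $\Re(\beta)>0$, then the integral defining $H_m^{\beta}(x)$ converges absolutely and uniformly in $x$ on $\mathbb{R}$ as an improper Riemann integral. 2. If $m>2$ and $\Re(\beta)=0$, then the integral defining $H_m^{\beta}(x)$ converges uniformly in $x$ on $\mathbb{R}$ as an improper Riemann integral. 3. If $m=2$ and $\Re(\beta)=0$, then for any compact set $K\subseteq\mathbb{R}$, the integral defining $H_m^{\beta}(x)$ converges uniformly in $x$ on $K$ as an improper Riemann integral.
   Context: The integral is said to converge uniformly in $x$ on $S\subseteq\mathbb{R}$ if it converges as an improper Riemann integral for each $x\in S$ and, for each $\epsilon>0$, there exists $M_\epsilon>0$ such that $$\left|H_m^{\beta}(x)-\frac{1}{2\pi}\int_{-M}^{M}e^{-ixu}e^{-\beta u^m}\,du\right|<\epsilon$$ for all $M\geq M_\epsilon$ and all $x\in S$. *)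

theory Defs
  imports "HOL-Analysis.Analysis"
begin

text \<open>
  The library's \<^const>\<open>integral\<close> is the gauge (Henstock--Kurzweil) integral, which integrates more
  functions than Riemann's. Riemann integrability is therefore a separate notion here: the size of
  the subintervals is bounded by one constant instead of by a gauge. For a Riemann integrable
  function the two integrals agree (lemma \<open>has_riemann_integral_imp_has_integral\<close>), so
  \<^const>\<open>integral\<close> denotes the Riemann integral then.
\<close>

definition has_riemann_integral ::
    "(real \<Rightarrow> 'a::real_normed_vector) \<Rightarrow> 'a \<Rightarrow> real \<Rightarrow> real \<Rightarrow> bool" where
  "has_riemann_integral f I a b \<longleftrightarrow>
     (\<forall>\<epsilon>>0. \<exists>\<delta>>0. \<forall>p. p tagged_division_of {a..b} \<and> (\<forall>(t, K)\<in>p. measure lborel K < \<delta>) \<longrightarrow>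
        norm ((\<Sum>(t, K)\<in>p. measure lborel K *\<^sub>R f t) - I) < \<epsilon>)"

definition riemann_integrable ::
    "(real \<Rightarrow> 'a::real_normed_vector) \<Rightarrow> real \<Rightarrow> real \<Rightarrow> bool" where
  "riemann_integrable f a b \<longleftrightarrow> (\<exists>I. has_riemann_integral f I a b)"

lemma has_riemann_integral_imp_has_integral:
  fixes f :: "real \<Rightarrow> 'a::real_normed_vector"
  assumes "has_riemann_integral f I a b"
  shows "(f has_integral I) {a..b}"
  unfolding box_real(2)[symmetric] has_integral
proof (intro allI impI)
  fix e :: real assume "e > 0"
  then obtain d where d: "d > 0" and *: "\<And>p. p tagged_division_of {a..b} \<Longrightarrow>
      (\<forall>(t, K)\<in>p. measure lborel K < d) \<Longrightarrow> norm ((\<Sum>(t, K)\<in>p. measure lborel K *\<^sub>R f t) - I) < e"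
    using assms unfolding has_riemann_integral_def by meson
  have small: "measure lborel K < d" if p: "p tagged_division_of {a..b}"
    and fine: "(\<lambda>x. ball x (d / 3)) fine p" and tK: "(t, K) \<in> p" for p t K
  proof -
    obtain u v where K: "K = {u..v}"
      using tagged_division_ofD(4)[OF p tK] by auto
    have t: "t \<in> K" by (rule tagged_division_ofD(2)[OF p tK])
    have "u \<in> K" "v \<in> K" using t K by auto
    then have "u \<in> ball t (d / 3)" "v \<in> ball t (d / 3)"
      using fineD[OF fine tK] by blast+
    then show ?thesis using K t d by (auto simp: dist_real_def)
  qed
  show "\<exists>\<gamma>. gauge \<gamma> \<and> (\<forall>\<D>. \<D> tagged_division_of cbox a b \<and> \<gamma> fine \<D> \<longrightarrow>
      norm ((\<Sum>(x, k)\<in>\<D>. measure lborel k *\<^sub>R f x) - I) < e)"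
    using d small by (intro exI[of _ "\<lambda>x. ball x (d / 3)"]) (auto intro!: * gauge_ball)
qed

text \<open>
  Convergence over the whole line means that the two endpoints tend to infinity independently of
  each other; a principal value is not enough.
\<close>

definition has_improper_riemann_integral ::
    "(real \<Rightarrow> 'a::real_normed_vector) \<Rightarrow> 'a \<Rightarrow> bool" where
  "has_improper_riemann_integral f I \<longleftrightarrow>
     (\<forall>a b. a \<le> b \<longrightarrow> riemann_integrable f a b) \<and>
     ((\<lambda>(a, b). integral {a..b} f) \<longlongrightarrow> I) (at_bot \<times>\<^sub>F at_top)"

definition improper_riemann_convergent ::
    "(real \<Rightarrow> 'a::real_normed_vector) \<Rightarrow> bool" where
  "improper_riemann_convergent f \<longleftrightarrow> (\<exists>I. has_improper_riemann_integral f I)"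

definition improper_riemann_integral ::
    "(real \<Rightarrow> 'a::real_normed_vector) \<Rightarrow> 'a" where
  "improper_riemann_integral f = (THE I. has_improper_riemann_integral f I)"

definition H_integrand :: "nat \<Rightarrow> complex \<Rightarrow> real \<Rightarrow> real \<Rightarrow> complex" where
  "H_integrand m \<beta> x u = exp (- \<i> * of_real x * of_real u) * exp (- \<beta> * of_real u ^ m)"

definition H :: "nat \<Rightarrow> complex \<Rightarrow> real \<Rightarrow> complex" where
  "H m \<beta> x = 1 / (2 * of_real pi) * improper_riemann_integral (H_integrand m \<beta> x)"

definition H_converges_absolutely_on :: "nat \<Rightarrow> complex \<Rightarrow> real set \<Rightarrow> bool" where
  "H_converges_absolutely_on m \<beta> S \<longleftrightarrow>
     (\<forall>x\<in>S. improper_riemann_convergent (\<lambda>u. norm (H_integrand m \<beta> x u)))"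

text \<open>
  The truncation in the uniform estimate is symmetric, whereas the pointwise convergence is in the
  two-sided sense above.
\<close>

definition H_converges_uniformly_on :: "nat \<Rightarrow> complex \<Rightarrow> real set \<Rightarrow> bool" where
  "H_converges_uniformly_on m \<beta> S \<longleftrightarrow>
     (\<forall>x\<in>S. improper_riemann_convergent (H_integrand m \<beta> x)) \<and>
     (\<forall>\<epsilon>>0. \<exists>M\<^sub>\<epsilon>>0. \<forall>M\<ge>M\<^sub>\<epsilon>. \<forall>x\<in>S.
        norm (H m \<beta> x - 1 / (2 * of_real pi) * integral {-M..M} (H_integrand m \<beta> x)) < \<epsilon>)"

end

theory Submission imports Defs begin

text \<open>
  The integrand is continuous, hence Riemann integrable on bounded intervals, so everything is a
  matter of tails: if the integrals over \<open>[a, b]\<close> and \<open>[-b, -a]\<close> are at most \<open>\<epsilon>\<close> in norm for all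
  \<open>A \<le> a \<le> b\<close>, with one \<open>A\<close> serving all \<open>x \<in> S\<close>, then the Cauchy criterion gives two-sided convergence for
  each \<open>x\<close>, and the truncation error at \<open>A\<close> is at most \<open>2\<epsilon>\<close> uniformly in \<open>x\<close>
  (\<open>improper_riemann_integral_from_tails\<close>, \<open>H_converges_uniformly_onI\<close>). The substitution \<open>u \<mapsto> -u\<close>
  replaces \<open>\<beta>\<close> by \<open>(-1)\<^sup>m \<beta>\<close> and \<open>x\<close> by \<open>-x\<close>, so only right-hand tails need to be estimated.

  For even \<open>m\<close> and \<open>Re \<beta> > 0\<close> the modulus \<open>exp (-Re \<beta> u\<^sup>m)\<close> does not depend on \<open>x\<close> and is at most
  \<open>exp (-Re \<beta> u)\<close> for \<open>u \<ge> 1\<close>; evenness makes the left tail as good as the right one.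

  For \<open>Re \<beta> = 0\<close> the modulus is \<open>1\<close>, and the tails are small only through oscillation. Up to
  complex conjugation the integrand is \<open>cis \<phi>\<close> with \<open>\<phi> u = y u + c u\<^sup>m\<close>, where \<open>c = \<bar>Im \<beta>\<bar> > 0\<close> and
  \<open>\<bar>y\<bar> = \<bar>x\<bar>\<close>. For suitable \<open>x\<close> the stationary point of \<open>\<phi>\<close> lies arbitrarily far out, so on no tail
  is \<open>\<phi>'\<close> bounded away from \<open>0\<close> uniformly in \<open>x \<in> \<real>\<close>. The second derivative, however,
  does not involve \<open>x\<close>, and for \<open>m > 2\<close> it grows without bound: van der Corput's estimate \<open>6 / sqrt \<rho>\<close> for phases with \<open>\<phi>'' \<ge> \<rho>\<close> then gives tails that
  are small uniformly in \<open>x\<close>. For \<open>m = 2\<close> the second derivative is constant and this fails, but if \<open>x\<close>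
  is confined to a compact set, \<open>\<phi>'\<close> itself tends to infinity uniformly, and the first-derivative
  estimate \<open>2 / \<mu>\<close> for \<open>\<phi>' \<ge> \<mu>\<close> applies.
\<close>

section \<open>Continuous functions are Riemann integrable\<close>

text \<open>
  By uniform continuity a single mesh bound makes the oscillation of \<open>f\<close> on every piece at most \<open>\<eta>\<close>, so
  that each term of the Riemann sum differs from the integral over its piece by at most \<open>\<eta>\<close> times the
  length of the piece.
\<close>

lemma has_riemann_integral_continuous:
  fixes f :: "real \<Rightarrow> 'a::banach"
  assumes "a \<le> b" and cont: "continuous_on {a..b} f"
  shows "has_riemann_integral f (integral {a..b} f) a b"
  unfolding has_riemann_integral_def
proof (intro allI impI)
  fix \<epsilon> :: real assume "\<epsilon> > 0"
  define \<eta> where "\<eta> = \<epsilon> / (2 * (b - a + 1))"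
  have "\<eta> > 0" using \<open>\<epsilon> > 0\<close> \<open>a \<le> b\<close> by (simp add: \<eta>_def)
  have "uniformly_continuous_on {a..b} f"
    using cont by (intro compact_uniformly_continuous) auto
  then obtain \<delta> where "\<delta> > 0" and
    \<delta>: "\<And>s t. s \<in> {a..b} \<Longrightarrow> t \<in> {a..b} \<Longrightarrow> dist s t < \<delta> \<Longrightarrow> dist (f s) (f t) < \<eta>"
    unfolding uniformly_continuous_on_def using \<open>\<eta> > 0\<close> by metis
  have "norm ((\<Sum>(t, K)\<in>p. measure lborel K *\<^sub>R f t) - integral {a..b} f) < \<epsilon>"
    if p: "p tagged_division_of {a..b}" and fine: "\<forall>(t, K)\<in>p. measure lborel K < \<delta>" for p
  proof -
    have piece: "norm (measure lborel K *\<^sub>R f t - integral K f) \<le> \<eta> * measure lborel K"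
      if tK: "(t, K) \<in> p" for t K
    proof -
      have sub: "K \<subseteq> {a..b}" and "t \<in> K"
        using tagged_division_ofD(2,3)[OF p tK] by auto
      obtain u v where K: "K = {u..v}"
        using tagged_division_ofD(4)[OF p tK] by auto
      have uv: "u \<le> v" using \<open>t \<in> K\<close> K by auto
      have "v - u < \<delta>" using fine tK K uv by auto
      have contK: "continuous_on {u..v} f" using cont sub K continuous_on_subset by blast
      have "norm (integral {u..v} (\<lambda>s. f t - f s)) \<le> \<eta> * (v - u)"
      proof (rule integral_bound)
        fix s assume "s \<in> {u..v}"
        then have "dist t s < \<delta>" "s \<in> {a..b}" "t \<in> {a..b}"
          using \<open>t \<in> K\<close> K sub \<open>v - u < \<delta>\<close> by (auto simp: dist_real_def)
        then show "norm (f t - f s) \<le> \<eta>"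
          using \<delta> by (force simp: dist_norm)
      qed (use uv contK in \<open>auto intro!: continuous_intros\<close>)
      moreover have "integral {u..v} (\<lambda>s. f t - f s) = (v - u) *\<^sub>R f t - integral {u..v} f"
        using uv by (subst integral_diff) (auto intro!: integrable_continuous_real contK)
      ultimately show ?thesis using K uv by simp
    qed
    have "integral {a..b} f = (\<Sum>(t, K)\<in>p. integral K f)"
      using integral_combine_tagged_division_topdown[of f a b p] p cont
      by (simp add: integrable_continuous_real)
    then have "norm ((\<Sum>(t, K)\<in>p. measure lborel K *\<^sub>R f t) - integral {a..b} f)
        = norm (\<Sum>(t, K)\<in>p. measure lborel K *\<^sub>R f t - integral K f)"
      by (simp add: sum_subtractf case_prod_unfold)
    also have "\<dots> \<le> (\<Sum>(t, K)\<in>p. \<eta> * measure lborel K)"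
      using piece by (intro sum_norm_le) auto
    also have "\<dots> = \<eta> * (b - a)"
      using additive_content_tagged_division[of p a b] p \<open>a \<le> b\<close>
      by (simp add: sum_distrib_left[symmetric] case_prod_unfold)
    also have "\<dots> < \<epsilon>"
    proof -
      have "\<eta> * (b - a) \<le> \<epsilon> / 2"
        using \<open>a \<le> b\<close> \<open>\<epsilon> > 0\<close> by (simp add: \<eta>_def field_simps)
      then show ?thesis using \<open>\<epsilon> > 0\<close> by simp
    qed
    finally show ?thesis .
  qed
  then show "\<exists>\<delta>>0. \<forall>p. p tagged_division_of {a..b} \<and> (\<forall>(t, K)\<in>p. measure lborel K < \<delta>) \<longrightarrow>
      norm ((\<Sum>(t, K)\<in>p. measure lborel K *\<^sub>R f t) - integral {a..b} f) < \<epsilon>"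
    using \<open>\<delta> > 0\<close> by blast
qed

section \<open>Improper integrals of functions with small tails\<close>

text \<open>
  The condition \<open>0 \<le> A\<close> lets the origin serve as the base point of all half-line integrals.
\<close>

definition tail_bound :: "(real \<Rightarrow> 'a::real_normed_vector) \<Rightarrow> real \<Rightarrow> real \<Rightarrow> bool" where
  "tail_bound f A \<epsilon> \<longleftrightarrow> 0 \<le> A \<and> (\<forall>a b. A \<le> a \<longrightarrow> a \<le> b \<longrightarrow> norm (integral {a..b} f) \<le> \<epsilon>)"

lemma tail_bound_mono: "tail_bound f A \<epsilon> \<Longrightarrow> A \<le> B \<Longrightarrow> tail_bound f B \<epsilon>"
  unfolding tail_bound_def by (meson order_trans)

text \<open>
  The Cauchy criterion, with the quantitative form that the uniform estimate needs: the same \<open>A\<close> that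
  bounds the tails by \<open>\<epsilon>\<close> bounds the truncation error, because the error is itself a limit of tail
  integrals.
\<close>

lemma half_line_integral_limit:
  fixes f :: "real \<Rightarrow> 'a::banach"
  assumes cont: "continuous_on UNIV f" and tails: "\<And>\<epsilon>. \<epsilon> > 0 \<Longrightarrow> \<exists>A. tail_bound f A \<epsilon>"
  obtains L where "\<And>A \<epsilon>. tail_bound f A \<epsilon> \<Longrightarrow> norm (integral {0..A} f - L) \<le> \<epsilon>"
proof -
  define J where "J n = integral {0..real n} f" for n
  have diff: "integral {0..b} f - integral {0..a} f = integral {a..b} f"
    if "0 \<le> a" "a \<le> b" for a b :: real
    using Henstock_Kurzweil_Integration.integral_combine[where a = 0 and c = a and b = b and f = f] that cont
    by (metis (no_types) add_diff_cancel_left' continuous_on_subset integrable_continuous_real subset_UNIV)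
  have "Cauchy J"
  proof (rule CauchyI')
    fix \<epsilon> :: real assume "\<epsilon> > 0"
    then obtain A where A: "tail_bound f A (\<epsilon> / 2)" using tails[of "\<epsilon> / 2"] by auto
    have "dist (J k) (J n) < \<epsilon>" if "nat \<lceil>A\<rceil> \<le> k" "k < n" for k n
    proof -
      have "A \<le> real k" using that(1) by linarith
      then have "norm (J n - J k) \<le> \<epsilon> / 2"
        using A that(2) by (simp add: J_def diff tail_bound_def)
      then show ?thesis using \<open>\<epsilon> > 0\<close> by (simp add: dist_norm norm_minus_commute)
    qed
    then show "\<exists>N. \<forall>k\<ge>N. \<forall>n>k. dist (J k) (J n) < \<epsilon>" by blast
  qed
  then obtain L where L: "J \<longlonglongrightarrow> L" using Cauchy_convergent convergent_def by blast
  have "norm (integral {0..A} f - L) \<le> \<epsilon>" if A: "tail_bound f A \<epsilon>" for A \<epsilon>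
  proof (rule Lim_norm_ubound)
    show "(\<lambda>n. integral {0..A} f - J n) \<longlonglongrightarrow> integral {0..A} f - L"
      by (intro tendsto_intros L)
    have "norm (integral {0..A} f - J n) \<le> \<epsilon>" if "nat \<lceil>A\<rceil> \<le> n" for n
    proof -
      have "A \<le> real n" using that by linarith
      then show ?thesis
        using A diff[of A "real n"] by (simp add: J_def tail_bound_def norm_minus_commute[of "integral {0..A} f"])
    qed
    then show "\<forall>\<^sub>F n in sequentially. norm (integral {0..A} f - J n) \<le> \<epsilon>"
      using eventually_sequentially by blast
  qed simp
  then show thesis by (rule that)
qed

text \<open>
  Splitting at the origin and reflecting the left half reduces the two-sided limit to two half-line
  limits; each contributes one \<open>\<epsilon>\<close> to the truncation error.
\<close>

lemma improper_riemann_integral_from_tails: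
  fixes f :: "real \<Rightarrow> 'a::banach"
  assumes cont: "continuous_on UNIV f"
    and tails: "\<And>\<epsilon>. \<epsilon> > 0 \<Longrightarrow> \<exists>A. tail_bound f A \<epsilon> \<and> tail_bound (\<lambda>u. f (- u)) A \<epsilon>"
  obtains I where "has_improper_riemann_integral f I"
    and "\<And>A \<epsilon>. tail_bound f A \<epsilon> \<Longrightarrow> tail_bound (\<lambda>u. f (- u)) A \<epsilon> \<Longrightarrow>
           norm (I - integral {-A..A} f) \<le> 2 * \<epsilon>"
proof -
  let ?g = "\<lambda>u. f (- u)"
  have contg: "continuous_on UNIV ?g"
    by (rule continuous_on_compose2[OF cont]) (auto intro!: continuous_intros)
  obtain L where L: "\<And>A \<epsilon>. tail_bound f A \<epsilon> \<Longrightarrow> norm (integral {0..A} f - L) \<le> \<epsilon>"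
    using half_line_integral_limit[OF cont] tails by metis
  obtain L' where L': "\<And>A \<epsilon>. tail_bound ?g A \<epsilon> \<Longrightarrow> norm (integral {0..A} ?g - L') \<le> \<epsilon>"
    using half_line_integral_limit[OF contg] tails by metis
  have split: "integral {-a..b} f = integral {0..a} ?g + integral {0..b} f"
    if "0 \<le> a" "0 \<le> b" for a b :: real
  proof -
    have "integral {-a..b} f = integral {-a..0} f + integral {0..b} f"
      using that cont
      by (intro Henstock_Kurzweil_Integration.integral_combine[symmetric] integrable_continuous_real)
         (auto intro: continuous_on_subset)
    also have "integral {-a..0} f = integral {0..a} ?g"
      using Henstock_Kurzweil_Integration.integral_reflect_real[where f = ?g and a = 0 and b = a] by simp
    finally show ?thesis .
  qed
  have close: "norm (integral {-a..b} f - (L' + L)) \<le> 2 * \<epsilon>"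
    if "tail_bound ?g a \<epsilon>" "tail_bound f b \<epsilon>" for a b \<epsilon>
  proof -
    have "integral {-a..b} f - (L' + L) = (integral {0..a} ?g - L') + (integral {0..b} f - L)"
      using that by (simp add: split tail_bound_def)
    also have "norm \<dots> \<le> \<epsilon> + \<epsilon>"
      by (rule norm_triangle_mono[OF L'[OF that(1)] L[OF that(2)]])
    finally show ?thesis by simp
  qed
  have "((\<lambda>(a, b). integral {a..b} f) \<longlongrightarrow> L' + L) (at_bot \<times>\<^sub>F at_top)"
  proof (rule tendstoI)
    fix \<epsilon> :: real assume "\<epsilon> > 0"
    then obtain A where A: "tail_bound f A (\<epsilon> / 3)" "tail_bound ?g A (\<epsilon> / 3)"
      using tails[of "\<epsilon> / 3"] by auto
    have "dist (integral {a..b} f) (L' + L) < \<epsilon>" if "a \<le> - A" "b \<ge> A" for a b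
      using close[of "- a" "\<epsilon> / 3" b] tail_bound_mono[OF A(1), of b] tail_bound_mono[OF A(2), of "- a"]
        that \<open>\<epsilon> > 0\<close> by (simp add: dist_norm)
    then show "\<forall>\<^sub>F p in at_bot \<times>\<^sub>F at_top. dist (case p of (a, b) \<Rightarrow> integral {a..b} f) (L' + L) < \<epsilon>"
      unfolding eventually_prod_filter
      by (intro exI[of _ "\<lambda>a. a \<le> - A"] exI[of _ "\<lambda>b. b \<ge> A"]) auto
  qed
  moreover have "riemann_integrable f a b" if "a \<le> b" for a b
    unfolding riemann_integrable_def
    using has_riemann_integral_continuous[OF that] cont continuous_on_subset by blast
  ultimately have "has_improper_riemann_integral f (L' + L)"
    by (simp add: has_improper_riemann_integral_def)
  then show thesis
    using that close by (simp add: norm_minus_commute)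
qed

lemma improper_riemann_integral_eqI:
  fixes f :: "real \<Rightarrow> 'a::real_normed_vector"
  assumes "has_improper_riemann_integral f I"
  shows "improper_riemann_integral f = I"
  unfolding improper_riemann_integral_def
proof (rule the_equality, rule assms)
  fix J assume "has_improper_riemann_integral f J"
  then show "J = I"
    using assms tendsto_unique[of "at_bot \<times>\<^sub>F at_top :: (real \<times> real) filter"]
    unfolding has_improper_riemann_integral_def by (auto simp: prod_filter_eq_bot)
qed

section \<open>Van der Corput estimates\<close>

lemma integrable_on_cis:
  assumes "\<And>u. u \<in> {a..b} \<Longrightarrow> (\<phi> has_real_derivative \<phi>' u) (at u)"
  shows "(\<lambda>u. cis (\<phi> u)) integrable_on {a..b}"
  using has_real_derivative_imp_continuous_on[of "{a..b}" \<phi> \<phi>'] assms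
  by (intro integrable_continuous_real continuous_intros) auto

lemma norm_integral_cis_le_length:
  assumes "a \<le> b" and "\<And>u. u \<in> {a..b} \<Longrightarrow> (\<phi> has_real_derivative \<phi>' u) (at u)"
  shows "norm (integral {a..b} (\<lambda>u. cis (\<phi> u))) \<le> b - a"
proof -
  have "norm (integral {a..b} (\<lambda>u. cis (\<phi> u))) \<le> integral {a..b} (\<lambda>u. 1)"
    using assms by (intro integral_norm_bound_integral integrable_on_cis[where \<phi>' = \<phi>']) auto
  then show ?thesis using assms(1) by simp
qed

text \<open>
  Integration by parts: \<open>cis \<phi> = (cis \<phi>)' / (\<i> \<phi>')\<close>, so the integral equals the boundary terms of
  \<open>G = cis \<phi> / (\<i> \<phi>')\<close> up to a remainder of modulus at most the integral of \<open>w = \<kappa> / \<phi>'\<^sup>2 = - (1 / \<phi>')'\<close>.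
  Boundary terms and remainder are at most \<open>1 / \<phi>' b + 1 / \<phi>' a\<close> and \<open>1 / \<phi>' a - 1 / \<phi>' b\<close>, which add
  up to \<open>2 / \<phi>' a\<close>.
\<close>

lemma van_der_corput_first_derivative:
  fixes \<phi> \<phi>' \<kappa> :: "real \<Rightarrow> real"
  assumes "a \<le> b" "\<mu> > 0"
    and d1: "\<And>u. u \<in> {a..b} \<Longrightarrow> (\<phi> has_real_derivative \<phi>' u) (at u)"
    and d2: "\<And>u. u \<in> {a..b} \<Longrightarrow> (\<phi>' has_real_derivative \<kappa> u) (at u)"
    and convex: "\<And>u. u \<in> {a..b} \<Longrightarrow> \<kappa> u \<ge> 0"
    and fast: "\<And>u. u \<in> {a..b} \<Longrightarrow> \<phi>' u \<ge> \<mu>"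
  shows "norm (integral {a..b} (\<lambda>u. cis (\<phi> u))) \<le> 2 / \<mu>"
proof -
  have pos: "\<phi>' u > 0" if "u \<in> {a..b}" for u
    using fast[OF that] \<open>\<mu> > 0\<close> by simp
  define w where "w u = \<kappa> u / (\<phi>' u)\<^sup>2" for u
  define G where "G u = - \<i> * (inverse (\<phi>' u) *\<^sub>R cis (\<phi> u))" for u
  define E where "E u = cis (\<phi> u) + \<i> * (w u *\<^sub>R cis (\<phi> u))" for u
  have int_cis: "(\<lambda>u. cis (\<phi> u)) integrable_on {a..b}"
    by (rule integrable_on_cis) (rule d1)
  have dinv: "((\<lambda>u. inverse (\<phi>' u)) has_real_derivative - w u) (at u)" if "u \<in> {a..b}" for u
    using pos[OF that] DERIV_inverse_fun[OF d2[OF that]]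
    by (simp add: w_def field_simps power2_eq_square)
  have int_w: "(w has_integral (inverse (\<phi>' a) - inverse (\<phi>' b))) {a..b}"
  proof -
    have "((\<lambda>u. - w u) has_integral (inverse (\<phi>' b) - inverse (\<phi>' a))) {a..b}"
      using dinv \<open>a \<le> b\<close>
      by (intro fundamental_theorem_of_calculus)
         (auto simp: has_real_derivative_iff_has_vector_derivative intro: has_vector_derivative_at_within)
    from has_integral_neg[OF this] show ?thesis by simp
  qed
  have int_E: "(E has_integral (G b - G a)) {a..b}"
  proof (rule fundamental_theorem_of_calculus[OF \<open>a \<le> b\<close>])
    fix u assume u: "u \<in> {a..b}"
    have "((\<lambda>u. cis (\<phi> u)) has_vector_derivative \<phi>' u *\<^sub>R (\<i> * cis (\<phi> u))) (at u)"
      using has_derivative_cis[OF d1[OF u, unfolded has_field_derivative_def]]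
      by (simp add: has_vector_derivative_def mult.commute)
    from has_vector_derivative_scaleR[OF dinv[OF u] this]
    have "((\<lambda>u. inverse (\<phi>' u) *\<^sub>R cis (\<phi> u)) has_vector_derivative
        \<i> * cis (\<phi> u) - w u *\<^sub>R cis (\<phi> u)) (at u)"
      using pos[OF u] by simp
    from has_vector_derivative_mult_right[OF this, of "- \<i>"]
    have "(G has_vector_derivative E u) (at u)"
      unfolding G_def E_def by (simp add: algebra_simps flip: mult.assoc)
    then show "(G has_vector_derivative E u) (at u within {a..b})"
      by (rule has_vector_derivative_at_within)
  qed
  \<comment> \<open>As \<open>w \<ge> 0\<close>, bounding the remainder by the integral of \<open>w\<close> loses nothing to cancellation, and that
    integral telescopes; this is where monotonicity of \<open>\<phi>'\<close> enters.\<close>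
  have *: "((\<lambda>u. E u - cis (\<phi> u)) has_integral (G b - G a - integral {a..b} (\<lambda>u. cis (\<phi> u)))) {a..b}"
    by (intro has_integral_diff int_E integrable_integral int_cis)
  have "norm (integral {a..b} (\<lambda>u. E u - cis (\<phi> u))) \<le> integral {a..b} w"
    using * int_w convex
    by (intro integral_norm_bound_integral) (auto simp: E_def w_def norm_mult)
  then have "norm (G b - G a - integral {a..b} (\<lambda>u. cis (\<phi> u))) \<le> inverse (\<phi>' a) - inverse (\<phi>' b)"
    using integral_unique[OF *] integral_unique[OF int_w] by simp
  moreover have "norm (G b - G a) \<le> inverse (\<phi>' b) + inverse (\<phi>' a)"
    using norm_triangle_ineq4[of "G b" "G a"] pos[of a] pos[of b] \<open>a \<le> b\<close>
    by (simp add: G_def norm_mult)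
  moreover have "norm (integral {a..b} (\<lambda>u. cis (\<phi> u))) \<le>
      norm (G b - G a) + norm (G b - G a - integral {a..b} (\<lambda>u. cis (\<phi> u)))"
    using norm_triangle_ineq4[of "G b - G a" "G b - G a - integral {a..b} (\<lambda>u. cis (\<phi> u))"] by simp
  ultimately have "norm (integral {a..b} (\<lambda>u. cis (\<phi> u))) \<le> 2 * inverse (\<phi>' a)"
    by linarith
  also have "\<dots> \<le> 2 / \<mu>"
    using fast[of a] \<open>a \<le> b\<close> \<open>\<mu> > 0\<close> by (simp add: field_simps)
  finally show ?thesis .
qed

text \<open>
  Close to a point where \<open>\<phi>'\<close> may vanish there is no oscillation to exploit, so the trivial bound is used
  on a stretch of length \<open>h\<close>, beyond which \<open>\<phi>' \<ge> \<rho> h\<close>. The choice \<open>h = 1 / sqrt \<rho>\<close> gives the two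
  contributions \<open>h\<close> and \<open>2 / (\<rho> h)\<close> the same order.
\<close>

lemma van_der_corput_right_of_stationary_point:
  fixes \<phi> \<phi>' \<kappa> :: "real \<Rightarrow> real"
  assumes "a \<le> b" "\<rho> > 0"
    and d1: "\<And>u. u \<in> {a..b} \<Longrightarrow> (\<phi> has_real_derivative \<phi>' u) (at u)"
    and d2: "\<And>u. u \<in> {a..b} \<Longrightarrow> (\<phi>' has_real_derivative \<kappa> u) (at u)"
    and convex: "\<And>u. u \<in> {a..b} \<Longrightarrow> \<kappa> u \<ge> 0"
    and growth: "\<And>u. u \<in> {a..b} \<Longrightarrow> \<phi>' u \<ge> \<rho> * (u - a)"
  shows "norm (integral {a..b} (\<lambda>u. cis (\<phi> u))) \<le> 3 / sqrt \<rho>"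
proof -
  define h where "h = 1 / sqrt \<rho>"
  have "h > 0" using \<open>\<rho> > 0\<close> by (simp add: h_def)
  have rh: "\<rho> * h = sqrt \<rho>"
    using \<open>\<rho> > 0\<close> by (simp add: h_def real_div_sqrt)
  show ?thesis
  proof (cases "b \<le> a + h")
    case True
    then have "norm (integral {a..b} (\<lambda>u. cis (\<phi> u))) \<le> h"
      using norm_integral_cis_le_length[OF \<open>a \<le> b\<close> d1] by simp
    then show ?thesis using \<open>h > 0\<close> by (simp add: h_def field_simps)
  next
    case False
    have "norm (integral {a..a + h} (\<lambda>u. cis (\<phi> u))) \<le> (a + h) - a"
      using d1 False \<open>h > 0\<close> by (intro norm_integral_cis_le_length[where \<phi>' = \<phi>']) auto
    moreover have "norm (integral {a + h..b} (\<lambda>u. cis (\<phi> u))) \<le> 2 / (\<rho> * h)"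
    proof (rule van_der_corput_first_derivative[where \<phi>' = \<phi>' and \<kappa> = \<kappa>])
      fix u assume u: "u \<in> {a + h..b}"
      have "\<rho> * h \<le> \<rho> * (u - a)" using u \<open>\<rho> > 0\<close> by auto
      also have "\<dots> \<le> \<phi>' u" using growth[of u] u \<open>h > 0\<close> by auto
      finally show "\<rho> * h \<le> \<phi>' u" .
    qed (use d1 d2 convex False \<open>h > 0\<close> \<open>\<rho> > 0\<close> in auto)
    moreover have "integral {a..b} (\<lambda>u. cis (\<phi> u)) =
        integral {a..a + h} (\<lambda>u. cis (\<phi> u)) + integral {a + h..b} (\<lambda>u. cis (\<phi> u))"
      using d1 False \<open>h > 0\<close> by (intro Henstock_Kurzweil_Integration.integral_combine[symmetric]
        integrable_on_cis[where \<phi>' = \<phi>']) auto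
    ultimately have "norm (integral {a..b} (\<lambda>u. cis (\<phi> u))) \<le> h + 2 / (\<rho> * h)"
      using norm_triangle_ineq[of "integral {a..a + h} (\<lambda>u. cis (\<phi> u))" "integral {a + h..b} (\<lambda>u. cis (\<phi> u))"]
      by simp
    also have "\<dots> = 3 / sqrt \<rho>"
      unfolding rh by (simp add: h_def)
    finally show ?thesis .
  qed
qed

text \<open>
  As \<open>\<phi>'\<close> increases at rate at least \<open>\<rho>\<close>, there is a point \<open>c\<close>, the zero of \<open>\<phi>'\<close> or an endpoint if
  \<open>\<phi>'\<close> has constant sign, on either side of which \<open>\<phi>'\<close> moves away from \<open>0\<close> at this rate. The part to the
  right of \<open>c\<close> is covered by \<open>van_der_corput_right_of_stationary_point\<close>, and so is the
  part to the left after the reflection \<open>u \<mapsto> -u\<close>, which preserves convexity of the phase.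
\<close>

lemma van_der_corput_second_derivative:
  fixes \<phi> \<phi>' \<kappa> :: "real \<Rightarrow> real"
  assumes "a \<le> b" "\<rho> > 0"
    and d1: "\<And>u. u \<in> {a..b} \<Longrightarrow> (\<phi> has_real_derivative \<phi>' u) (at u)"
    and d2: "\<And>u. u \<in> {a..b} \<Longrightarrow> (\<phi>' has_real_derivative \<kappa> u) (at u)"
    and convex: "\<And>u. u \<in> {a..b} \<Longrightarrow> \<kappa> u \<ge> \<rho>"
  shows "norm (integral {a..b} (\<lambda>u. cis (\<phi> u))) \<le> 6 / sqrt \<rho>"
proof -
  have incr: "\<phi>' v - \<phi>' u \<ge> \<rho> * (v - u)" if "u \<in> {a..b}" "v \<in> {a..b}" "u \<le> v" for u v
  proof -
    have "\<phi>' u - \<rho> * u \<le> \<phi>' v - \<rho> * v"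
    proof (rule DERIV_nonneg_imp_nondecreasing[OF \<open>u \<le> v\<close>])
      fix x assume "u \<le> x" "x \<le> v"
      then have x: "x \<in> {a..b}" using that by auto
      have "((\<lambda>u. \<phi>' u - \<rho> * u) has_real_derivative \<kappa> x - \<rho>) (at x)"
        using d2[OF x] by (auto intro!: derivative_eq_intros)
      then show "\<exists>y. ((\<lambda>u. \<phi>' u - \<rho> * u) has_real_derivative y) (at x) \<and> 0 \<le> y"
        using convex[OF x] by (intro exI[of _ "\<kappa> x - \<rho>"]) auto
    qed
    then show ?thesis by (simp add: algebra_simps)
  qed
  obtain c where c: "c \<in> {a..b}" and right: "c < b \<Longrightarrow> \<phi>' c \<ge> 0" and left: "a < c \<Longrightarrow> \<phi>' c \<le> 0"
  proof -
    consider "\<phi>' a \<ge> 0" | "\<phi>' b \<le> 0" | "\<phi>' a \<le> 0" "0 \<le> \<phi>' b" by linarith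
    then show thesis
    proof cases
      case 3
      have "continuous_on {a..b} \<phi>'"
        using d2 by (rule has_real_derivative_imp_continuous_on)
      with 3 obtain c where "a \<le> c" "c \<le> b" "\<phi>' c = 0"
        using IVT'[of \<phi>' a 0 b] \<open>a \<le> b\<close> by blast
      then show thesis by (intro that[of c]) auto
    qed (use that[of a] that[of b] \<open>a \<le> b\<close> in auto)
  qed
  have nonneg: "\<kappa> u \<ge> 0" if "u \<in> {a..b}" for u
    using convex[OF that] \<open>\<rho> > 0\<close> by simp
  have "norm (integral {c..b} (\<lambda>u. cis (\<phi> u))) \<le> 3 / sqrt \<rho>"
  proof (cases "c < b")
    case True
    show ?thesis
    proof (rule van_der_corput_right_of_stationary_point[where \<phi>' = \<phi>' and \<kappa> = \<kappa>])
      fix u assume "u \<in> {c..b}"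
      then show "\<phi>' u \<ge> \<rho> * (u - c)" using incr[of c u] right[OF True] c by auto
    qed (use c d1 d2 nonneg \<open>\<rho> > 0\<close> in auto)
  qed (use c \<open>\<rho> > 0\<close> in simp)
  moreover have "norm (integral {a..c} (\<lambda>u. cis (\<phi> u))) \<le> 3 / sqrt \<rho>"
  proof (cases "a < c")
    case True
    have "norm (integral {-c..-a} (\<lambda>u. cis (\<phi> (- u)))) \<le> 3 / sqrt \<rho>"
    proof (rule van_der_corput_right_of_stationary_point
        [where \<phi>' = "\<lambda>u. - \<phi>' (- u)" and \<kappa> = "\<lambda>u. \<kappa> (- u)"])
      fix u assume u: "u \<in> {-c..-a}"
      then have mem: "- u \<in> {a..b}" using c by auto
      show "((\<lambda>u. \<phi> (- u)) has_real_derivative - \<phi>' (- u)) (at u)"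
        using DERIV_mirror d1[OF mem] by blast
      show "((\<lambda>u. - \<phi>' (- u)) has_real_derivative \<kappa> (- u)) (at u)"
        using DERIV_minus DERIV_mirror d2[OF mem] by fastforce
      show "\<kappa> (- u) \<ge> 0" by (rule nonneg[OF mem])
      show "- \<phi>' (- u) \<ge> \<rho> * (u - - c)"
        using incr[of "- u" c] left[OF True] c u by (auto simp: add.commute)
    qed (use c \<open>\<rho> > 0\<close> in auto)
    then show ?thesis
      using Henstock_Kurzweil_Integration.integral_reflect_real[where f = "\<lambda>u. cis (\<phi> u)" and a = a and b = c] by simp
  qed (use c \<open>\<rho> > 0\<close> in simp)
  moreover have "integral {a..b} (\<lambda>u. cis (\<phi> u)) =
      integral {a..c} (\<lambda>u. cis (\<phi> u)) + integral {c..b} (\<lambda>u. cis (\<phi> u))"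
    using d1 c by (intro Henstock_Kurzweil_Integration.integral_combine[symmetric]
        integrable_on_cis[where \<phi>' = \<phi>']) auto
  ultimately show ?thesis
    using norm_triangle_ineq[of "integral {a..c} (\<lambda>u. cis (\<phi> u))" "integral {c..b} (\<lambda>u. cis (\<phi> u))"]
    by simp
qed

section \<open>Tails of the integrand\<close>

lemma continuous_on_H_integrand: "continuous_on S (H_integrand m \<beta> x)"
  unfolding H_integrand_def by (intro continuous_intros)

lemma H_integrand_reflect: "H_integrand m \<beta> x (- u) = H_integrand m ((-1) ^ m * \<beta>) (- x) u"
  by (simp add: H_integrand_def power_minus[of "complex_of_real u"] mult_ac)

lemma norm_H_integrand: "norm (H_integrand m \<beta> x u) = exp (- Re \<beta> * u ^ m)"
  by (simp add: H_integrand_def norm_mult flip: of_real_power)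

lemma H_integrand_eq_cis:
  assumes "Re \<beta> = 0"
  shows "H_integrand m \<beta> x u = cis (- (x * u + Im \<beta> * u ^ m))"
proof -
  obtain b where b: "\<beta> = \<i> * of_real b"
    using assms by (metis Complex_eq complex_surj complex_eq_iff mult.commute add_0 of_real_0)
  have "- \<i> * of_real x * of_real u + - \<beta> * of_real u ^ m = \<i> * of_real (- (x * u + Im \<beta> * u ^ m))"
    by (simp add: b algebra_simps)
  then show ?thesis by (simp only: H_integrand_def mult_exp_exp cis_conv_exp)
qed

text \<open>
  Conjugation reverses the sign of the phase without changing the modulus of the integral, so the
  phase may be taken convex on the positive half-line.
\<close>

lemma norm_integral_H_integrand_eq_convex_phase:
  assumes "Re \<beta> = 0" "\<beta> \<noteq> 0"
  shows "norm (integral {a..b} (H_integrand m \<beta> x)) =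
    norm (integral {a..b} (\<lambda>u. cis (sgn (Im \<beta>) * x * u + \<bar>Im \<beta>\<bar> * u ^ m)))"
proof (cases "Im \<beta> < 0")
  case True
  then have "H_integrand m \<beta> x = (\<lambda>u. cis (sgn (Im \<beta>) * x * u + \<bar>Im \<beta>\<bar> * u ^ m))"
    using assms by (intro ext) (simp add: H_integrand_eq_cis)
  then show ?thesis by simp
next
  case False
  then have "Im \<beta> > 0" using assms by (simp add: complex_eq_iff)
  then have "(\<lambda>u. cnj (H_integrand m \<beta> x u)) = (\<lambda>u. cis (sgn (Im \<beta>) * x * u + \<bar>Im \<beta>\<bar> * u ^ m))"
    using assms by (intro ext) (simp add: H_integrand_eq_cis cis_cnj add.commute)
  then show ?thesis by (metis complex_mod_cnj integral_cnj)
qed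

lemma tail_bound_if_exp_decay:
  fixes f :: "real \<Rightarrow> 'a::banach"
  assumes "continuous_on UNIV f" "r > 0" "A \<ge> 0"
    and decay: "\<And>u. u \<ge> A \<Longrightarrow> norm (f u) \<le> exp (- r * u)"
    and small: "exp (- r * A) / r \<le> \<epsilon>"
  shows "tail_bound f A \<epsilon>"
  unfolding tail_bound_def
proof (intro conjI allI impI)
  fix a b assume "A \<le> a" "a \<le> b"
  have int: "((\<lambda>u. exp (- r * u)) has_integral (- exp (- r * b) / r - - exp (- r * a) / r)) {a..b}"
    using \<open>r > 0\<close> \<open>a \<le> b\<close>
    by (intro fundamental_theorem_of_calculus)
       (auto simp: has_real_derivative_iff_has_vector_derivative[symmetric] intro!: derivative_eq_intros)
  have "norm (integral {a..b} f) \<le> integral {a..b} (\<lambda>u. exp (- r * u))"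
  proof (rule integral_norm_bound_integral)
    show "f integrable_on {a..b}"
      using assms(1) by (intro integrable_continuous_real) (rule continuous_on_subset, auto)
  qed (use int decay \<open>A \<le> a\<close> in auto)
  also have "\<dots> \<le> exp (- r * a) / r"
    using integral_unique[OF int] \<open>r > 0\<close> by simp
  also have "\<dots> \<le> exp (- r * A) / r"
    using \<open>A \<le> a\<close> \<open>r > 0\<close> by (intro divide_right_mono) auto
  finally show "norm (integral {a..b} f) \<le> \<epsilon>" using small by linarith
qed (rule \<open>A \<ge> 0\<close>)

lemma H_tail_bound_exponential:
  assumes "m \<ge> 1" "Re \<beta> > 0" "\<epsilon> > 0"
  obtains A where "\<And>x. tail_bound (H_integrand m \<beta> x) A \<epsilon>"
    and "\<And>x. tail_bound (\<lambda>u. norm (H_integrand m \<beta> x u)) A \<epsilon>"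
proof -
  define r where "r = Re \<beta>"
  have "r > 0" using assms by (simp add: r_def)
  \<comment> \<open>The second entry solves \<open>exp (- r * A) / r = \<epsilon>\<close>.\<close>
  define A where "A = max 1 (- ln (\<epsilon> * r) / r)"
  have "- r * A \<le> ln (\<epsilon> * r)"
    using \<open>r > 0\<close> by (simp add: A_def max_def field_simps)
  then have "exp (- r * A) \<le> \<epsilon> * r"
    using \<open>r > 0\<close> \<open>\<epsilon> > 0\<close> by (metis exp_le_cancel_iff exp_ln mult_pos_pos)
  then have small: "exp (- r * A) / r \<le> \<epsilon>"
    using \<open>r > 0\<close> by (simp add: field_simps)
  have "1 \<le> A" by (simp add: A_def)
  have decay: "norm (H_integrand m \<beta> x u) \<le> exp (- r * u)" if "u \<ge> A" for x u
  proof -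
    have "u \<le> u ^ m" using self_le_power[of u m] that \<open>1 \<le> A\<close> \<open>m \<ge> 1\<close> by simp
    then show ?thesis using \<open>r > 0\<close> by (simp add: norm_H_integrand r_def)
  qed
  show thesis
  proof (rule that)
    show "tail_bound (H_integrand m \<beta> x) A \<epsilon>" for x
      using \<open>r > 0\<close> \<open>1 \<le> A\<close> decay small
      by (intro tail_bound_if_exp_decay[of _ r] continuous_on_H_integrand) auto
    show "tail_bound (\<lambda>u. norm (H_integrand m \<beta> x u)) A \<epsilon>" for x
      using \<open>r > 0\<close> \<open>1 \<le> A\<close> decay small
      by (intro tail_bound_if_exp_decay[of _ r] continuous_on_norm continuous_on_H_integrand) auto
  qed
qed

text \<open>
  For \<open>u \<ge> A \<ge> 1\<close> the second derivative \<open>c m (m - 1) u\<^bsup>m - 2\<^esup>\<close> of the phase is at least \<open>c A\<close>, whatever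
  \<open>x\<close> is.
\<close>

lemma H_tail_bound_oscillatory:
  assumes "m > 2" "Re \<beta> = 0" "\<beta> \<noteq> 0" "\<epsilon> > 0"
  obtains A where "\<And>x. tail_bound (H_integrand m \<beta> x) A \<epsilon>"
proof -
  define c where "c = \<bar>Im \<beta>\<bar>"
  have "c > 0" using assms by (simp add: c_def complex_eq_iff)
  \<comment> \<open>The second entry solves \<open>6 / sqrt (c * A) = \<epsilon>\<close>.\<close>
  define A where "A = max 1 (36 / (c * \<epsilon>\<^sup>2))"
  have "A \<ge> 1" by (simp add: A_def)
  have "36 \<le> c * A * \<epsilon>\<^sup>2"
    using \<open>c > 0\<close> \<open>\<epsilon> > 0\<close> by (simp add: A_def max_def field_simps)
  then have "6 \<le> sqrt (c * A) * \<epsilon>"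
    using real_sqrt_le_mono[of "6\<^sup>2" "c * A * \<epsilon>\<^sup>2"] \<open>\<epsilon> > 0\<close> by (simp add: real_sqrt_mult)
  then have small: "6 / sqrt (c * A) \<le> \<epsilon>"
    using \<open>c > 0\<close> \<open>A \<ge> 1\<close> by (simp add: field_simps)
  have "norm (integral {a..b} (H_integrand m \<beta> x)) \<le> \<epsilon>" if "A \<le> a" "a \<le> b" for a b x
  proof -
    define y where "y = sgn (Im \<beta>) * x"
    have "norm (integral {a..b} (\<lambda>u. cis (y * u + c * u ^ m))) \<le> 6 / sqrt (c * A)"
    proof (rule van_der_corput_second_derivative
        [where \<phi>' = "\<lambda>u. y + c * (m * u ^ (m - 1))"
          and \<kappa> = "\<lambda>u. c * (m * ((m - 1) * u ^ (m - 2)))"])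
      fix u assume "u \<in> {a..b}"
      show "((\<lambda>u. y * u + c * u ^ m) has_real_derivative y + c * (m * u ^ (m - 1))) (at u)"
        by (auto intro!: derivative_eq_intros)
      show "((\<lambda>u. y + c * (m * u ^ (m - 1))) has_real_derivative
          c * (m * ((m - 1) * u ^ (m - 2)))) (at u)"
        using \<open>m > 2\<close> by (auto intro!: derivative_eq_intros simp: numeral_2_eq_2)
      have "A \<le> u ^ (m - 2)"
        using self_le_power[of u "m - 2"] \<open>u \<in> {a..b}\<close> \<open>A \<ge> 1\<close> \<open>A \<le> a\<close> \<open>m > 2\<close> by auto
      then have "1 * (1 * A) \<le> m * ((m - 1) * u ^ (m - 2))"
        using \<open>A \<ge> 1\<close> \<open>m > 2\<close> by (intro mult_mono) auto
      then show "c * A \<le> c * (m * ((m - 1) * u ^ (m - 2)))"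
        using \<open>c > 0\<close> by simp
    qed (use that \<open>c > 0\<close> \<open>A \<ge> 1\<close> in auto)
    then show ?thesis
      using small assms by (simp add: norm_integral_H_integrand_eq_convex_phase y_def c_def)
  qed
  then show thesis
    using \<open>A \<ge> 1\<close> by (intro that[of A]) (auto simp: tail_bound_def)
qed

text \<open>
  Beyond \<open>B / c\<close> the derivative \<open>y + 2 c u\<close> of the phase is at least \<open>c u\<close>, since \<open>\<bar>y\<bar> \<le> B \<le> c u\<close>; the
  stationary point \<open>- y / (2 c)\<close> has been left behind.
\<close>

lemma H_tail_bound_fresnel:
  assumes "Re \<beta> = 0" "\<beta> \<noteq> 0" "\<epsilon> > 0"
  obtains A where "\<And>x. \<bar>x\<bar> \<le> B \<Longrightarrow> tail_bound (H_integrand 2 \<beta> x) A \<epsilon>"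
proof -
  define c where "c = \<bar>Im \<beta>\<bar>"
  have "c > 0" using assms by (simp add: c_def complex_eq_iff)
  \<comment> \<open>The first entry gives \<open>\<phi>' \<ge> c * A\<close> on the tail, the second solves \<open>2 / (c * A) = \<epsilon>\<close>.\<close>
  define A where "A = max (\<bar>B\<bar> / c) (2 / (c * \<epsilon>))"
  have "A > 0" using \<open>c > 0\<close> \<open>\<epsilon> > 0\<close> by (simp add: A_def less_max_iff_disj)
  have cA: "\<bar>B\<bar> \<le> c * A" and "2 \<le> c * A * \<epsilon>"
    using \<open>c > 0\<close> \<open>\<epsilon> > 0\<close> by (simp_all add: A_def max_def field_simps)
  then have small: "2 / (c * A) \<le> \<epsilon>"
    using \<open>c > 0\<close> \<open>A > 0\<close> by (simp add: field_simps)
  have "norm (integral {a..b} (H_integrand 2 \<beta> x)) \<le> \<epsilon>"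
    if "A \<le> a" "a \<le> b" "\<bar>x\<bar> \<le> B" for a b x
  proof -
    define y where "y = sgn (Im \<beta>) * x"
    have y: "\<bar>y\<bar> \<le> B"
      using that(3) assms by (simp add: y_def abs_mult abs_sgn_eq complex_eq_iff)
    have "norm (integral {a..b} (\<lambda>u. cis (y * u + c * u ^ 2))) \<le> 2 / (c * A)"
    proof (rule van_der_corput_first_derivative
        [where \<phi>' = "\<lambda>u. y + 2 * (c * u)" and \<kappa> = "\<lambda>u. 2 * c"])
      fix u assume "u \<in> {a..b}"
      show "((\<lambda>u. y * u + c * u ^ 2) has_real_derivative y + 2 * (c * u)) (at u)"
        by (auto intro!: derivative_eq_intros)
      show "((\<lambda>u. y + 2 * (c * u)) has_real_derivative 2 * c) (at u)"
        by (auto intro!: derivative_eq_intros)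
      have "c * A \<le> c * u" using \<open>u \<in> {a..b}\<close> \<open>A \<le> a\<close> \<open>c > 0\<close> by auto
      then show "c * A \<le> y + 2 * (c * u)" using y cA by linarith
    qed (use that \<open>c > 0\<close> \<open>A > 0\<close> in auto)
    then show ?thesis
      using small assms by (simp add: norm_integral_H_integrand_eq_convex_phase y_def c_def)
  qed
  then show thesis
    using \<open>A > 0\<close> by (intro that[of A]) (auto simp: tail_bound_def)
qed

text \<open>
  The left tails are stated as right tails of the reflected integrand. The factor \<open>1 / (2 * pi)\<close>
  absorbs the factor \<open>2\<close> in the truncation error, so the tail bound \<open>\<epsilon>\<close> itself suffices.
\<close>

lemma H_converges_uniformly_onI:
  assumes right: "\<And>\<epsilon>. \<epsilon> > 0 \<Longrightarrow> \<exists>A. \<forall>x\<in>S. tail_bound (H_integrand m \<beta> x) A \<epsilon>"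
    and left: "\<And>\<epsilon>. \<epsilon> > 0 \<Longrightarrow> \<exists>A. \<forall>x\<in>S. tail_bound (H_integrand m ((-1) ^ m * \<beta>) (- x)) A \<epsilon>"
  shows "H_converges_uniformly_on m \<beta> S"
proof -
  let ?tails = "\<lambda>x A \<epsilon>. tail_bound (H_integrand m \<beta> x) A \<epsilon> \<and>
    tail_bound (\<lambda>u. H_integrand m \<beta> x (- u)) A \<epsilon>"
  have tails: "\<exists>A. \<forall>x\<in>S. ?tails x A \<epsilon>" if pos: "\<epsilon> > 0" for \<epsilon>
  proof -
    obtain A1 A2 where "\<forall>x\<in>S. tail_bound (H_integrand m \<beta> x) A1 \<epsilon>"
      "\<forall>x\<in>S. tail_bound (\<lambda>u. H_integrand m \<beta> x (- u)) A2 \<epsilon>"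
      using right[OF pos] left[OF pos] by (auto simp: H_integrand_reflect)
    then show ?thesis
      by (intro exI[of _ "max A1 A2"]) (meson max.cobounded1 max.cobounded2 tail_bound_mono)
  qed
  have ex: "\<exists>I. has_improper_riemann_integral (H_integrand m \<beta> x) I \<and>
      (\<forall>A \<epsilon>. ?tails x A \<epsilon> \<longrightarrow> norm (I - integral {-A..A} (H_integrand m \<beta> x)) \<le> 2 * \<epsilon>)"
    if "x \<in> S" for x
    using improper_riemann_integral_from_tails[OF continuous_on_H_integrand[of UNIV m \<beta> x]] tails that
    by metis
  show ?thesis
    unfolding H_converges_uniformly_on_def
  proof (intro conjI ballI allI impI)
    show "improper_riemann_convergent (H_integrand m \<beta> x)" if "x \<in> S" for x
      using ex[OF that] by (auto simp: improper_riemann_convergent_def)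
  next
    fix \<epsilon> :: real assume "\<epsilon> > 0"
    then obtain A where A: "\<forall>x\<in>S. ?tails x A \<epsilon>" using tails by blast
    have "norm (H m \<beta> x - 1 / (2 * of_real pi) * integral {-M..M} (H_integrand m \<beta> x)) < \<epsilon>"
      if M: "M \<ge> max A 1" and "x \<in> S" for M x
    proof -
      obtain I where I: "has_improper_riemann_integral (H_integrand m \<beta> x) I"
        and close: "\<And>A \<epsilon>. ?tails x A \<epsilon> \<Longrightarrow> norm (I - integral {-A..A} (H_integrand m \<beta> x)) \<le> 2 * \<epsilon>"
        using ex[OF \<open>x \<in> S\<close>] by blast
      have "H m \<beta> x = 1 / (2 * of_real pi) * I"
        by (simp add: H_def improper_riemann_integral_eqI[OF I])
      then have "norm (H m \<beta> x - 1 / (2 * of_real pi) * integral {-M..M} (H_integrand m \<beta> x))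
          = norm (1 / (2 * of_real pi) * (I - integral {-M..M} (H_integrand m \<beta> x)))"
        by (simp only: right_diff_distrib)
      also have "\<dots> = norm (I - integral {-M..M} (H_integrand m \<beta> x)) / (2 * pi)"
        by (simp add: norm_mult norm_divide)
      also have "\<dots> \<le> 2 * \<epsilon> / (2 * pi)"
      proof (rule divide_right_mono)
        show "norm (I - integral {-M..M} (H_integrand m \<beta> x)) \<le> 2 * \<epsilon>"
          using A M \<open>x \<in> S\<close> by (intro close) (auto intro: tail_bound_mono)
      qed simp
      also have "\<dots> < \<epsilon>"
        using \<open>\<epsilon> > 0\<close> pi_gt3 by (simp add: field_simps)
      finally show ?thesis .
    qed
    then show "\<exists>M\<^sub>\<epsilon>>0. \<forall>M\<ge>M\<^sub>\<epsilon>. \<forall>x\<in>S.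
        norm (H m \<beta> x - 1 / (2 * of_real pi) * integral {-M..M} (H_integrand m \<beta> x)) < \<epsilon>"
      by (intro exI[of _ "max A 1"]) auto
  qed
qed

theorem proposition4p1:
  fixes m :: nat and \<beta> :: complex
  assumes "m \<ge> 2" and "\<beta> \<noteq> 0" and "Re \<beta> \<ge> 0"
  shows "(even m \<and> Re \<beta> > 0 \<longrightarrow>
            H_converges_absolutely_on m \<beta> UNIV \<and> H_converges_uniformly_on m \<beta> UNIV) \<and>
         (m > 2 \<and> Re \<beta> = 0 \<longrightarrow> H_converges_uniformly_on m \<beta> UNIV) \<and>
         (m = 2 \<and> Re \<beta> = 0 \<longrightarrow> (\<forall>K. compact K \<longrightarrow> H_converges_uniformly_on m \<beta> K))"
proof (intro conjI impI allI)
  assume "even m \<and> Re \<beta> > 0"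
  then have refl: "(-1) ^ m * \<beta> = \<beta>" and "Re \<beta> > 0" and "m \<ge> 1" using \<open>m \<ge> 2\<close> by auto
  note tail = H_tail_bound_exponential[OF \<open>m \<ge> 1\<close> \<open>Re \<beta> > 0\<close>]
  show "H_converges_uniformly_on m \<beta> UNIV"
  proof (rule H_converges_uniformly_onI, unfold refl)
    fix \<epsilon> :: real assume "\<epsilon> > 0"
    from tail[OF this] show "\<exists>A. \<forall>x\<in>UNIV. tail_bound (H_integrand m \<beta> x) A \<epsilon>"
      and "\<exists>A. \<forall>x\<in>UNIV. tail_bound (H_integrand m \<beta> (- x)) A \<epsilon>" by metis+
  qed
  show "H_converges_absolutely_on m \<beta> UNIV"
    unfolding H_converges_absolutely_on_def improper_riemann_convergent_def
  proof
    fix x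
    let ?f = "\<lambda>u. norm (H_integrand m \<beta> x u)"
    have "\<exists>A. tail_bound ?f A \<epsilon> \<and> tail_bound (\<lambda>u. ?f (- u)) A \<epsilon>" if "\<epsilon> > 0" for \<epsilon>
      using tail[OF that] unfolding H_integrand_reflect refl by metis
    moreover have "continuous_on UNIV ?f"
      by (intro continuous_on_norm continuous_on_H_integrand)
    ultimately show "\<exists>I. has_improper_riemann_integral ?f I"
      using improper_riemann_integral_from_tails[of ?f] by metis
  qed
next
  assume "m > 2 \<and> Re \<beta> = 0"
  then have "m > 2" "Re \<beta> = 0" "Re ((-1) ^ m * \<beta>) = 0" "(-1) ^ m * \<beta> \<noteq> 0"
    using \<open>\<beta> \<noteq> 0\<close> by (auto simp: minus_one_power_iff)
  then show "H_converges_uniformly_on m \<beta> UNIV"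
    using \<open>\<beta> \<noteq> 0\<close> by (intro H_converges_uniformly_onI) (meson H_tail_bound_oscillatory)+
next
  fix K :: "real set"
  assume m: "m = 2 \<and> Re \<beta> = 0" and "compact K"
  then obtain B where B: "\<And>x. x \<in> K \<Longrightarrow> \<bar>x\<bar> \<le> B"
    using compact_imp_bounded bounded_iff by (metis real_norm_def)
  have tail: "\<exists>A. \<forall>x. \<bar>x\<bar> \<le> B \<longrightarrow> tail_bound (H_integrand 2 \<beta> x) A \<epsilon>" if "\<epsilon> > 0" for \<epsilon>
    using H_tail_bound_fresnel[of \<beta> \<epsilon> B] m \<open>\<beta> \<noteq> 0\<close> that by metis
  show "H_converges_uniformly_on m \<beta> K"
  proof (rule H_converges_uniformly_onI)
    fix \<epsilon> :: real assume "\<epsilon> > 0"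
    from tail[OF this] obtain A where A: "\<And>x. \<bar>x\<bar> \<le> B \<Longrightarrow> tail_bound (H_integrand 2 \<beta> x) A \<epsilon>"
      by blast
    show "\<exists>A. \<forall>x\<in>K. tail_bound (H_integrand m \<beta> x) A \<epsilon>"
      using A B m by auto
    show "\<exists>A. \<forall>x\<in>K. tail_bound (H_integrand m ((-1) ^ m * \<beta>) (- x)) A \<epsilon>"
      using A B m by (intro exI[of _ A]) auto
  qed
qed

end
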